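(* The following two assertions are equivalent. (A) For all $r\ge1$, $(k_1,\dots,k_r)\in\mathbb{Z}_{\ge1}^r$ and $t\in\mathbb{Z}_{\ge0}$, \[ \sum_{\substack{m_1+\cdots+m_r=r+t\\ m_i\ge1}}\ \sum_{\substack{\mathbf{a}_i\in\mathbb{Z}_{\ge1}^{m_i},\ |\mathbf{a}_i|=k_i+m_i-1\\(1\le i\le r)}}\zeta^+(\mathbf{a}_1,\dots,\mathbf{a}_r) =\sum_{l=0}^{t}\ \sum_{\substack{m_1+\cdots+m_{r-1}=t-l\\ m_i\ge0}}\ \sum_{\substack{|\mathbf{e}|=l\\ \mathbf{e}\ge0}}\zeta^+\big((k_1,\{1\}^{m_1},\dots,k_{r-1},\{1\}^{m_{r-1}},k_r)+\mathbf{e}\big), \] where for $r=1$ the right-hand side is understood as $\zeta^+(k_1+t)$. (B) For all $r\ge1$, $\mathbf{k}\in\mathbb{Z}_{\ge1}^r$ and $l\in\mathbb{Z}_{\ge0}$, \[ \sum_{\substack{|\mathbf{e}|=l\\ \mathbf{e}\ge0}}\zeta^+(\mathbf{k}+\mathbf{e})=\sum_{\substack{|\mathbf{e}'|=l\\ \mathbf{e}'\ge0}}\zeta^+\big((\mathbf{k}^\vee+\mathbf{e}')^\vee\big), \] where $\mathbf{e}$ has the depth of $\mathbf{k}$ and $\mathbf{e}'$ has the depth of $\mathbf{k}^\vee$.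
   Context: For $k_1\ge2$, $\zeta(k_1,\dots,k_r)=\sum_{n_1>\cdots>n_r\ge1}n_1^{-k_1}\cdots n_r^{-k_r}$, and for $(k_1,\dots,k_r)\in\mathbb{Z}_{\ge1}^r$, $\zeta^+(k_1,\dots,k_r):=\zeta(k_1+1,k_2,\dots,k_r)$. For a tuple $\mathbf{k}$, $|\mathbf{k}|$ is the sum of its entries and its depth its length; $(\mathbf{a}_1,\dots,\mathbf{a}_r)$ is concatenation; $\mathbf{k}+\mathbf{e}$ is componentwise addition of tuples of equal depth; $\mathbf{e}\ge0$ means all components are non-negative integers; $\{1\}^m$ is $m$ entries equal to $1$. Hoffman's dual: for $\mathbf{k}=(k_1,\dots,k_r)$ of weight $n$, let $S(\mathbf{k})=\{k_1,k_1+k_2,\dots,k_1+\cdots+k_{r-1}\}\subseteq\{1,\dots,n-1\}$; then $\mathbf{k}^\vee$ is the unique index of weight $n$ with $S(\mathbf{k}^\vee)=\{1,\dots,n-1\}\setminus S(\mathbf{k})$. Equivalently, writing $\mathbf{k}=(\underbrace{1+\cdots+1}_{k_1},\dots,\underbrace{1+\cdots+1}_{k_r})$, $\mathbf{k}^\vee$ is obtained by exchanging the symbols "$+$" and "$,$". *)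

theory Defs
  imports "HOL-Analysis.Analysis"
begin

text \<open>Indices are lists of positive integers; the weight is \<^const>\<open>sum_list\<close> and the depth
  is \<^const>\<open>length\<close>.\<close>

definition index :: "nat list \<Rightarrow> bool" where
  "index ks \<longleftrightarrow> (\<forall>k\<in>set ks. 1 \<le> k)"

text \<open>The series is the unordered sum over all strictly decreasing tuples; its terms are
  nonnegative, and it converges when the first entry is at least 2.\<close>

definition mzv :: "nat list \<Rightarrow> real" where
  "mzv ks = (\<Sum>\<^sub>\<infinity>ns \<in> {ns. length ns = length ks \<and> sorted_wrt (>) ns \<and> (\<forall>n\<in>set ns. 1 \<le> n)}.
     \<Prod>i<length ks. 1 / real (ns ! i) ^ (ks ! i))"

definition mzv_plus :: "nat list \<Rightarrow> real" where
  "mzv_plus ks = mzv ((hd ks + 1) # tl ks)"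

definition weak_compositions :: "nat \<Rightarrow> nat \<Rightarrow> nat list set" where
  "weak_compositions d n = {es. length es = d \<and> sum_list es = n}"

definition compositions :: "nat \<Rightarrow> nat \<Rightarrow> nat list set" where
  "compositions d n = {ms. index ms \<and> length ms = d \<and> sum_list ms = n}"

definition tuple_add :: "nat list \<Rightarrow> nat list \<Rightarrow> nat list" where
  "tuple_add ks es = map2 (+) ks es"

text \<open>\<open>(k\<^sub>1, {1}\<^bsup>m\<^sub>1\<^esup>, \<dots>, k\<^bsub>r-1\<^esub>, {1}\<^bsup>m\<^bsub>r-1\<^esub>\<^esup>, k\<^sub>r)\<close>, for \<open>ms\<close> of length \<open>r - 1\<close>\<close>

definition insert_ones :: "nat list \<Rightarrow> nat list \<Rightarrow> nat list" where
  "insert_ones ks ms = concat (map2 (\<lambda>k m. k # replicate m 1) (butlast ks) ms) @ [last ks]"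

definition partial_sums :: "nat list \<Rightarrow> nat set" where
  "partial_sums ks = {sum_list (take j ks) | j. 1 \<le> j \<and> j < length ks}"

definition hoffman_dual :: "nat list \<Rightarrow> nat list" where
  "hoffman_dual ks = (THE ks'. index ks' \<and> sum_list ks' = sum_list ks \<and>
     partial_sums ks' = {1..<sum_list ks} - partial_sums ks)"

lemma partial_sums_Nil [simp]: "partial_sums [] = {}"
  by (simp add: partial_sums_def)

lemma partial_sums_single [simp]: "partial_sums [k] = {}"
  by (auto simp: partial_sums_def)

lemma partial_sums_Cons:
  assumes "ks \<noteq> []"
  shows "partial_sums (k # ks) = insert k ((+) k ` partial_sums ks)"
proof (intro equalityI subsetI)
  fix x assume "x \<in> partial_sums (k # ks)"
  then obtain j where j: "1 \<le> j" "j < Suc (length ks)" "x = sum_list (take j (k # ks))"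
    by (auto simp: partial_sums_def)
  then obtain i where i: "j = Suc i" by (cases j) auto
  show "x \<in> insert k ((+) k ` partial_sums ks)"
  proof (cases "i = 0")
    case False
    then have "sum_list (take i ks) \<in> partial_sums ks"
      using i j by (auto simp: partial_sums_def intro!: exI[of _ i])
    then show ?thesis using i j by auto
  qed (use i j in auto)
next
  fix x assume "x \<in> insert k ((+) k ` partial_sums ks)"
  then consider "x = k" | j where "1 \<le> j" "j < length ks" "x = k + sum_list (take j ks)"
    by (auto simp: partial_sums_def)
  then show "x \<in> partial_sums (k # ks)"
  proof cases
    case 1
    then show ?thesis using assms by (auto simp: partial_sums_def intro!: exI[of _ "Suc 0"])
  next
    case (2 j)
    then show ?thesis by (auto simp: partial_sums_def intro!: exI[of _ "Suc j"])
  qed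
qed

lemma index_partial_sums_exists:
  assumes "T \<subseteq> {1..<n}"
  shows "\<exists>ks. index ks \<and> sum_list ks = n \<and> partial_sums ks = T"
  using assms
proof (induction n arbitrary: T rule: less_induct)
  case (less n)
  show ?case
  proof (cases "T = {}")
    case True
    show ?thesis
    proof (cases "n = 0")
      case True
      with \<open>T = {}\<close> show ?thesis by (intro exI[of _ "[]"]) (auto simp: index_def)
    next
      case False
      with \<open>T = {}\<close> show ?thesis by (intro exI[of _ "[n]"]) (auto simp: index_def)
    qed
  next
    case False
    define a where "a = Min T"
    have fin: "finite T" using less.prems finite_subset by blast
    have aT: "a \<in> T" and amin: "\<And>x. x \<in> T \<Longrightarrow> a \<le> x"
      using fin False by (auto simp: a_def)
    have a: "1 \<le> a" "a < n" using aT less.prems by auto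
    define T' where "T' = (\<lambda>x. x - a) ` (T - {a})"
    have "T' \<subseteq> {1..<n - a}"
      using less.prems amin by (force simp: T'_def)
    moreover have "n - a < n" using a by simp
    ultimately obtain ks where ks: "index ks" "sum_list ks = n - a" "partial_sums ks = T'"
      using less.IH by blast
    have "ks \<noteq> []" using ks a by auto
    moreover have "(+) a ` T' = T - {a}"
      using amin by (force simp: T'_def image_image)
    ultimately have "partial_sums (a # ks) = T"
      using ks aT by (auto simp: partial_sums_Cons)
    then show ?thesis using ks a by (intro exI[of _ "a # ks"]) (auto simp: index_def)
  qed
qed

lemma partial_sums_pos: "index ks \<Longrightarrow> x \<in> partial_sums ks \<Longrightarrow> 1 \<le> x"
proof (induction ks arbitrary: x)
  case (Cons k ks)
  then show ?case by (cases "ks = []") (auto simp: partial_sums_Cons index_def)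
qed simp

lemma index_partial_sums_unique:
  assumes "index ks" "index ks'" "sum_list ks = sum_list ks'" "partial_sums ks = partial_sums ks'"
  shows "ks = ks'"
  using assms
proof (induction ks arbitrary: ks')
  case Nil
  then show ?case by (cases ks') (auto simp: index_def)
next
  case (Cons k ks)
  obtain k' ls where ks': "ks' = k' # ls"
    using Cons.prems by (cases ks') (auto simp: index_def)
  have idx: "index ks" "index ls" using Cons.prems ks' by (auto simp: index_def)
  show ?case
  proof (cases "ks = [] \<or> ls = []")
    case True
    then show ?thesis using Cons.prems ks' by (cases "ks = []"; cases "ls = []") (auto simp: partial_sums_Cons)
  next
    case False
    then have eq: "insert k ((+) k ` partial_sums ks) = insert k' ((+) k' ` partial_sums ls)"
      using Cons.prems ks' by (simp add: partial_sums_Cons)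
    have "k \<in> insert k' ((+) k' ` partial_sums ls)" "k' \<in> insert k ((+) k ` partial_sums ks)"
      using eq by blast+
    then have "k = k'" by auto
    have "k \<notin> (+) k ` partial_sums ks" "k \<notin> (+) k ` partial_sums ls"
      using partial_sums_pos idx by fastforce+
    then have "(+) k ` partial_sums ks = (+) k ` partial_sums ls"
      using eq \<open>k = k'\<close> by (simp add: insert_ident)
    then have "partial_sums ks = partial_sums ls"
      by (simp add: inj_image_eq_iff)
    then show ?thesis using Cons.IH[of ls] Cons.prems idx ks' \<open>k = k'\<close> by simp
  qed
qed

lemma hoffman_dual_ex1:
  "\<exists>!ks'. index ks' \<and> sum_list ks' = sum_list ks \<and>
     partial_sums ks' = {1..<sum_list ks} - partial_sums ks"
  using index_partial_sums_exists[of "{1..<sum_list ks} - partial_sums ks" "sum_list ks"]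
    index_partial_sums_unique by (metis Diff_subset)

lemma hoffman_dual:
  shows index_hoffman_dual: "index (hoffman_dual ks)"
    and sum_list_hoffman_dual: "sum_list (hoffman_dual ks) = sum_list ks"
    and partial_sums_hoffman_dual:
      "partial_sums (hoffman_dual ks) = {1..<sum_list ks} - partial_sums ks"
  using theI'[OF hoffman_dual_ex1[of ks]] unfolding hoffman_dual_def by auto

text \<open>In depth 1 the sum over \<open>ms\<close> is empty unless \<open>l = t\<close>, where it runs over the empty tuple
  only; this is the usual convention for the right-hand side.\<close>

lemma insert_ones_sum_depth_1:
  "(\<Sum>l=0..t. \<Sum>ms\<in>weak_compositions (length [k] - 1) (t - l).
      \<Sum>es\<in>weak_compositions (length (insert_ones [k] ms)) l.
        mzv_plus (tuple_add (insert_ones [k] ms) es)) = mzv_plus [k + t]"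
proof -
  have *: "weak_compositions 0 n = (if n = 0 then {[]} else {})" for n
    by (auto simp: weak_compositions_def)
  have **: "weak_compositions (Suc 0) n = {[n]}" for n
    by (auto simp: weak_compositions_def length_Suc_conv)
  have "(\<Sum>l=0..t. \<Sum>ms\<in>weak_compositions (length [k] - 1) (t - l).
      \<Sum>es\<in>weak_compositions (length (insert_ones [k] ms)) l.
        mzv_plus (tuple_add (insert_ones [k] ms) es))
    = (\<Sum>l=0..t. if l = t then mzv_plus [k + t] else 0)"
    by (intro sum.cong refl) (auto simp: * ** insert_ones_def tuple_add_def)
  then show ?thesis by simp
qed

end

theory Submission
  imports Defs
begin

text \<open>Write an index of weight \<open>n\<close> as a word of length \<open>n - 1\<close> in the letters ``+'' and ``,''.
  Prepending a letter means applying \<open>raise_hd\<close> or \<open>(#) 1\<close>, and Hoffman's dual exchanges the two.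
  The left-hand side of (B) inserts letters ``+'' in front of the letters ``,'' and at the end, and
  dually for the right-hand side. The left-hand side of (A) inserts letters ``,'' anywhere. This can
  be done in two stages: first repeat the letters ``,'' already present, which is \<open>insert_ones\<close>, then
  insert letters ``,'' in front of the letters ``+'' and at the end, which gives the right-hand side
  of (B). In terms of sums this follows by comparing Pascal-type recursions, which ask whether the
  new word starts with an inserted letter. So (A) is (B) convolved with \<open>insert_ones\<close>, and that
  convolution can be cancelled because its leading term is the identity.\<close>

section \<open>Indices built letter by letter\<close>

text \<open>The value at \<open>[]\<close> makes \<open>raise_hd\<close> dual to \<open>(#) 1\<close> for the empty index as well.\<close>

fun raise_hd :: "nat list \<Rightarrow> nat list" where
  "raise_hd [] = [1]"
| "raise_hd (k # ks) = Suc k # ks"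

lemma raise_hd_not_Nil [simp]: "raise_hd ks \<noteq> []"
  by (cases ks) auto

lemma length_raise_hd: "ks \<noteq> [] \<Longrightarrow> length (raise_hd ks) = length ks"
  by (cases ks) auto

lemma index_Nil [simp]: "index []"
  by (simp add: index_def)

lemma index_Cons [simp]: "index (k # ks) \<longleftrightarrow> 1 \<le> k \<and> index ks"
  by (simp add: index_def)

lemma index_raise_hd: "index ks \<Longrightarrow> index (raise_hd ks)"
  by (cases ks) auto

lemma index_tuple_add: "index ks \<Longrightarrow> index (tuple_add ks es)"
  unfolding tuple_add_def by (induction ks es rule: list_induct2') auto

lemma nonempty_index_induct [consumes 2, case_names one comma plus]:
  assumes "index ks" "ks \<noteq> []"
    and one: "P [1]"
    and comma: "\<And>ks. index ks \<Longrightarrow> ks \<noteq> [] \<Longrightarrow> P ks \<Longrightarrow> P (1 # ks)"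
    and plus: "\<And>ks. index ks \<Longrightarrow> ks \<noteq> [] \<Longrightarrow> P ks \<Longrightarrow> P (raise_hd ks)"
  shows "P ks"
  using assms(1,2)
proof (induction ks)
  case (Cons k ks)
  have "1 \<le> k" "index ks"
    using Cons.prems by auto
  moreover have "P (1 # ks)"
    using Cons one comma by (cases "ks = []") auto
  ultimately show ?case
  proof (induction k rule: nat_induct_at_least)
    case (Suc k)
    then show ?case using plus[of "k # ks"] by simp
  qed
qed simp

lemma sum_list_raise_hd: "sum_list (raise_hd ks) = Suc (sum_list ks)"
  by (cases ks) auto

lemma partial_sums_raise_hd: "partial_sums (raise_hd ks) = Suc ` partial_sums ks"
proof (cases ks)
  case (Cons k js)
  then show ?thesis by (cases "js = []") (auto simp: partial_sums_Cons image_image)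
qed simp

lemma hoffman_dual_eqI:
  assumes "index js" "sum_list js = sum_list ks"
    and "partial_sums js = {1..<sum_list ks} - partial_sums ks"
  shows "hoffman_dual ks = js"
  using assms by (intro index_partial_sums_unique) (simp_all add: hoffman_dual)

lemma hoffman_dual_Nil [simp]: "hoffman_dual [] = []"
  by (rule hoffman_dual_eqI) auto

lemma hoffman_dual_eq_Nil_iff:
  assumes "index ks"
  shows "hoffman_dual ks = [] \<longleftrightarrow> ks = []"
proof -
  have "sum_list js = 0 \<longleftrightarrow> js = []" if "index js" for js
    using that by (cases js) auto
  then show ?thesis
    using assms by (metis index_hoffman_dual sum_list_hoffman_dual)
qed

lemma hoffman_dual_Cons_1:
  assumes "index ks"
  shows "hoffman_dual (1 # ks) = raise_hd (hoffman_dual ks)"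
proof (rule hoffman_dual_eqI)
  have "{1..<Suc n} - insert 1 (Suc ` P) = Suc ` ({1..<n} - P)" for n P
    by (auto simp: image_set_diff)
  then show "partial_sums (raise_hd (hoffman_dual ks)) =
      {1..<sum_list (1 # ks)} - partial_sums (1 # ks)"
    by (cases "ks = []")
      (simp_all add: partial_sums_raise_hd partial_sums_hoffman_dual partial_sums_Cons)
qed (simp_all add: index_raise_hd sum_list_raise_hd hoffman_dual)

lemma hoffman_dual_raise_hd:
  assumes "index ks"
  shows "hoffman_dual (raise_hd ks) = 1 # hoffman_dual ks"
proof (rule hoffman_dual_eqI)
  show "partial_sums (1 # hoffman_dual ks) =
      {1..<sum_list (raise_hd ks)} - partial_sums (raise_hd ks)"
  proof (cases "hoffman_dual ks = []")
    case True
    then show ?thesis using assms by (simp add: hoffman_dual_eq_Nil_iff)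
  next
    case False
    then have "0 < sum_list ks"
      using assms by (cases ks) (auto simp: hoffman_dual_eq_Nil_iff)
    moreover have "insert 1 (Suc ` ({1..<n} - P)) = {1..<Suc n} - Suc ` P"
      if "0 < n" "0 \<notin> P" for n P
      using that by (auto simp: image_set_diff)
    moreover have "0 \<notin> partial_sums ks"
      using partial_sums_pos[OF assms, of 0] by auto
    ultimately show ?thesis
      using False by (simp add: partial_sums_Cons partial_sums_raise_hd partial_sums_hoffman_dual
          sum_list_raise_hd plus_1_eq_Suc del: One_nat_def)
  qed
qed (simp_all add: sum_list_raise_hd hoffman_dual)

lemma hoffman_dual_involutive:
  assumes "index ks"
  shows "hoffman_dual (hoffman_dual ks) = ks"
proof (cases "ks = []")
  case False
  with assms show ?thesis
    by (induction ks rule: nonempty_index_induct)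
      (simp_all add: hoffman_dual_Cons_1 hoffman_dual_raise_hd index_hoffman_dual del: One_nat_def)
qed simp

section \<open>Sums over weak compositions and compositions\<close>

lemma weak_compositions_0: "weak_compositions 0 n = (if n = 0 then {[]} else {})"
  by (auto simp: weak_compositions_def)

lemma weak_compositions_zero_sum: "weak_compositions d 0 = {replicate d 0}"
  by (auto simp: weak_compositions_def intro!: replicate_eqI)

lemma weak_compositions_1: "weak_compositions (Suc 0) n = {[n]}"
  by (auto simp: weak_compositions_def length_Suc_conv)

lemma weak_compositions_Suc:
  "weak_compositions (Suc d) n = (\<Union>j\<le>n. (#) j ` weak_compositions d (n - j))"
proof
  show "weak_compositions (Suc d) n \<subseteq> (\<Union>j\<le>n. (#) j ` weak_compositions d (n - j))"
  proof
    fix es assume "es \<in> weak_compositions (Suc d) n"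
    then obtain j js where "es = j # js" "length js = d" "j + sum_list js = n"
      by (auto simp: weak_compositions_def length_Suc_conv)
    then show "es \<in> (\<Union>j\<le>n. (#) j ` weak_compositions d (n - j))"
      by (intro UN_I[of j]) (auto simp: weak_compositions_def)
  qed
qed (auto simp: weak_compositions_def)

lemma finite_weak_compositions [simp]: "finite (weak_compositions d n)"
  by (induction d arbitrary: n) (auto simp: weak_compositions_0 weak_compositions_Suc)

lemma sum_weak_compositions_Suc:
  "(\<Sum>es\<in>weak_compositions (Suc d) n. f es) =
     (\<Sum>j\<le>n. \<Sum>es\<in>weak_compositions d (n - j). f (j # es))"
  unfolding weak_compositions_Suc
  by (subst sum.UNION_disjoint) (auto simp: sum.reindex)

lemma sum_weak_compositions_Suc_Suc:
  "(\<Sum>es\<in>weak_compositions (Suc d) (Suc n). f es) =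
     (\<Sum>es\<in>weak_compositions d (Suc n). f (0 # es)) +
     (\<Sum>es\<in>weak_compositions (Suc d) n. f (raise_hd es))"
  by (simp add: sum_weak_compositions_Suc sum.atMost_Suc_shift del: sum.atMost_Suc)

lemma compositions_eq_image_weak_compositions:
  "compositions d (d + n) = map Suc ` weak_compositions d n"
proof -
  have sum_list_map_Suc: "sum_list (map Suc es) = sum_list es + length es" for es
    by (induction es) auto
  show ?thesis
  proof
    show "compositions d (d + n) \<subseteq> map Suc ` weak_compositions d n"
    proof
      fix ms assume ms: "ms \<in> compositions d (d + n)"
      then have "\<forall>m\<in>set ms. \<exists>e. m = Suc e"
        by (auto simp: compositions_def index_def Suc_le_eq gr0_conv_Suc)
      then obtain es where "ms = map Suc es"
        unfolding ex_map_conv[symmetric] by blast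
      with ms show "ms \<in> map Suc ` weak_compositions d n"
        by (simp add: compositions_def weak_compositions_def sum_list_map_Suc)
    qed
  qed (auto simp: compositions_def weak_compositions_def index_def sum_list_map_Suc)
qed

lemma sum_compositions:
  "(\<Sum>ms\<in>compositions d (d + n). f ms) = (\<Sum>es\<in>weak_compositions d n. f (map Suc es))"
  by (simp add: compositions_eq_image_weak_compositions sum.reindex inj_on_def)

section \<open>Adding to the entries of an index\<close>

definition ohno_sum :: "(nat list \<Rightarrow> 'a :: comm_monoid_add) \<Rightarrow> nat list \<Rightarrow> nat \<Rightarrow> 'a" where
  "ohno_sum f ks l = (\<Sum>es\<in>weak_compositions (length ks) l. f (tuple_add ks es))"

definition dual_ohno_sum :: "(nat list \<Rightarrow> 'a :: comm_monoid_add) \<Rightarrow> nat list \<Rightarrow> nat \<Rightarrow> 'a" where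
  "dual_ohno_sum f ks = ohno_sum (\<lambda>js. f (hoffman_dual js)) (hoffman_dual ks)"

lemma ohno_sum_cong:
  assumes "index ks" "\<And>js. index js \<Longrightarrow> f js = g js"
  shows "ohno_sum f ks l = ohno_sum g ks l"
  using assms by (simp add: ohno_sum_def index_tuple_add)

lemma ohno_sum_0: "ohno_sum f ks 0 = f ks"
proof -
  have "tuple_add ks (replicate (length ks) 0) = ks"
    unfolding tuple_add_def by (induction ks) auto
  then show ?thesis by (simp add: ohno_sum_def weak_compositions_zero_sum)
qed

lemma ohno_sum_singleton: "ohno_sum f [k] l = f [k + l]"
  by (simp add: ohno_sum_def weak_compositions_1 tuple_add_def)

lemma tuple_add_raise_hd:
  assumes "ks \<noteq> []" "es \<noteq> []"
  shows tuple_add_raise_hd_left: "tuple_add (raise_hd ks) es = raise_hd (tuple_add ks es)"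
    and tuple_add_raise_hd_right: "tuple_add ks (raise_hd es) = raise_hd (tuple_add ks es)"
  using assms by (auto simp: tuple_add_def neq_Nil_conv)

lemma ohno_sum_raise_hd:
  assumes "ks \<noteq> []"
  shows "ohno_sum f (raise_hd ks) l = ohno_sum (\<lambda>js. f (raise_hd js)) ks l"
proof -
  have "tuple_add (raise_hd ks) es = raise_hd (tuple_add ks es)"
    if "es \<in> weak_compositions (length ks) l" for es
    using that assms by (intro tuple_add_raise_hd_left) (auto simp: weak_compositions_def)
  then show ?thesis
    using assms by (simp add: ohno_sum_def length_raise_hd)
qed

lemma ohno_sum_Cons_Suc:
  "ohno_sum f (k # ks) (Suc l) =
     ohno_sum (\<lambda>js. f (k # js)) ks (Suc l) + ohno_sum (\<lambda>js. f (raise_hd js)) (k # ks) l"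
proof -
  have "tuple_add (k # ks) (raise_hd es) = raise_hd (tuple_add (k # ks) es)"
    if "es \<in> weak_compositions (Suc (length ks)) l" for es
    using that by (intro tuple_add_raise_hd_right) (auto simp: weak_compositions_def)
  then show ?thesis
    by (simp add: ohno_sum_def sum_weak_compositions_Suc_Suc) (simp add: tuple_add_def)
qed

lemma dual_ohno_sum_0: "index ks \<Longrightarrow> dual_ohno_sum f ks 0 = f ks"
  by (simp add: dual_ohno_sum_def ohno_sum_0 hoffman_dual_involutive)

lemma dual_ohno_sum_1: "dual_ohno_sum f [1] l = f (replicate (Suc l) 1)"
proof -
  have "hoffman_dual [Suc l] = replicate (Suc l) 1" for l
  proof (induction l)
    case (Suc l)
    then show ?case using hoffman_dual_raise_hd[of "[Suc l]"] by simp
  qed (use hoffman_dual_raise_hd[of "[]"] in simp)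
  then show ?thesis by (simp add: dual_ohno_sum_def ohno_sum_singleton)
qed

lemma dual_ohno_sum_Cons_1:
  assumes "index ks" "ks \<noteq> []"
  shows "dual_ohno_sum f (1 # ks) l = dual_ohno_sum (\<lambda>js. f (1 # js)) ks l"
proof -
  have "dual_ohno_sum f (1 # ks) l =
      ohno_sum (\<lambda>js. f (hoffman_dual (raise_hd js))) (hoffman_dual ks) l"
    using assms
    by (simp add: dual_ohno_sum_def hoffman_dual_Cons_1 ohno_sum_raise_hd hoffman_dual_eq_Nil_iff
        del: One_nat_def)
  also have "\<dots> = dual_ohno_sum (\<lambda>js. f (1 # js)) ks l"
    unfolding dual_ohno_sum_def
    by (rule ohno_sum_cong) (simp_all add: index_hoffman_dual hoffman_dual_raise_hd)
  finally show ?thesis .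
qed

lemma dual_ohno_sum_raise_hd_Suc:
  assumes "index ks"
  shows "dual_ohno_sum f (raise_hd ks) (Suc l) =
    dual_ohno_sum (\<lambda>js. f (raise_hd js)) ks (Suc l) +
    dual_ohno_sum (\<lambda>js. f (1 # js)) (raise_hd ks) l"
proof -
  have "dual_ohno_sum f (raise_hd ks) (Suc l) =
      ohno_sum (\<lambda>js. f (hoffman_dual (1 # js))) (hoffman_dual ks) (Suc l) +
      ohno_sum (\<lambda>js. f (hoffman_dual (raise_hd js))) (1 # hoffman_dual ks) l"
    using assms by (simp add: dual_ohno_sum_def hoffman_dual_raise_hd ohno_sum_Cons_Suc)
  also have "ohno_sum (\<lambda>js. f (hoffman_dual (1 # js))) (hoffman_dual ks) (Suc l) =
      dual_ohno_sum (\<lambda>js. f (raise_hd js)) ks (Suc l)"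
    unfolding dual_ohno_sum_def
    by (rule ohno_sum_cong) (simp_all add: index_hoffman_dual hoffman_dual_Cons_1 del: One_nat_def)
  also have "ohno_sum (\<lambda>js. f (hoffman_dual (raise_hd js))) (1 # hoffman_dual ks) l =
      dual_ohno_sum (\<lambda>js. f (1 # js)) (raise_hd ks) l"
    unfolding dual_ohno_sum_def hoffman_dual_raise_hd[OF assms]
    by (rule ohno_sum_cong) (simp_all add: index_hoffman_dual hoffman_dual_raise_hd)
  finally show ?thesis .
qed

section \<open>Inserting ones into an index\<close>

definition insert_ones_sum :: "(nat list \<Rightarrow> 'a :: comm_monoid_add) \<Rightarrow> nat list \<Rightarrow> nat \<Rightarrow> 'a" where
  "insert_ones_sum f ks n = (\<Sum>ms\<in>weak_compositions (length ks - 1) n. f (insert_ones ks ms))"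

definition insert_ones_convolution ::
    "(nat list \<Rightarrow> nat \<Rightarrow> 'a :: comm_monoid_add) \<Rightarrow> nat list \<Rightarrow> nat \<Rightarrow> 'a" where
  "insert_ones_convolution F ks t = (\<Sum>l\<le>t. insert_ones_sum (\<lambda>js. F js l) ks (t - l))"

lemma insert_ones_not_Nil: "insert_ones ks ms \<noteq> []"
  by (simp add: insert_ones_def)

lemma insert_ones_Cons:
  "ks \<noteq> [] \<Longrightarrow> insert_ones (k # ks) (m # ms) = k # replicate m 1 @ insert_ones ks ms"
  by (simp add: insert_ones_def)

lemma insert_ones_raise_hd:
  assumes "ks \<noteq> []" "length ms = length ks - 1"
  shows "insert_ones (raise_hd ks) ms = raise_hd (insert_ones ks ms)"
proof -
  obtain k js where "ks = k # js" "length ms = length js"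
    using assms by (cases ks) auto
  then show ?thesis by (cases js; cases ms) (auto simp: insert_ones_def)
qed

lemma insert_ones_replicate_0:
  "ks \<noteq> [] \<Longrightarrow> insert_ones ks (replicate (length ks - 1) 0) = ks"
proof (induction ks)
  case (Cons k ks)
  then show ?case
    by (cases ks) (auto simp: insert_ones_Cons, simp add: insert_ones_def)
qed simp

lemma index_insert_ones:
  assumes "index ks" "ks \<noteq> []"
  shows "index (insert_ones ks ms)"
proof -
  have "index (concat (map2 (\<lambda>k m. k # replicate m 1) js ms))" if "index js" for js
    using that by (induction js arbitrary: ms) (auto simp: index_def dest!: set_zip_leftD)
  moreover have "index (butlast ks)" "1 \<le> last ks"
    using assms by (auto simp: index_def dest: in_set_butlastD)
  ultimately show ?thesis by (auto simp: insert_ones_def index_def)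
qed

lemma insert_ones_sum_cong:
  assumes "index ks" "ks \<noteq> []" "\<And>js. index js \<Longrightarrow> js \<noteq> [] \<Longrightarrow> f js = g js"
  shows "insert_ones_sum f ks n = insert_ones_sum g ks n"
  using assms by (simp add: insert_ones_sum_def index_insert_ones insert_ones_not_Nil)

lemma insert_ones_sum_0: "ks \<noteq> [] \<Longrightarrow> insert_ones_sum f ks 0 = f ks"
  using insert_ones_replicate_0[of ks] by (simp add: insert_ones_sum_def weak_compositions_zero_sum)

lemma insert_ones_sum_singleton: "insert_ones_sum f [k] n = (if n = 0 then f [k] else 0)"
  by (simp add: insert_ones_sum_def weak_compositions_0 insert_ones_def)

lemma insert_ones_sum_add:
  "insert_ones_sum (\<lambda>js. f js + g js) ks n = insert_ones_sum f ks n + insert_ones_sum g ks n"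
  by (simp add: insert_ones_sum_def sum.distrib)

lemma insert_ones_sum_raise_hd:
  assumes "ks \<noteq> []"
  shows "insert_ones_sum f (raise_hd ks) n = insert_ones_sum (\<lambda>js. f (raise_hd js)) ks n"
  using assms
  by (simp add: insert_ones_sum_def insert_ones_raise_hd length_raise_hd weak_compositions_def)

lemma insert_ones_sum_Cons_1_Suc:
  assumes "ks \<noteq> []"
  shows "insert_ones_sum f (1 # ks) (Suc n) =
    insert_ones_sum (\<lambda>js. f (1 # js)) ks (Suc n) + insert_ones_sum (\<lambda>js. f (1 # js)) (1 # ks) n"
proof -
  obtain d where d: "length ks = Suc d"
    using assms by (cases ks) auto
  have raise: "insert_ones (1 # ks) (raise_hd ms) = 1 # insert_ones (1 # ks) ms"
    if "ms \<in> weak_compositions (Suc d) n" for ms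
    using that assms by (cases ms) (auto simp: insert_ones_Cons weak_compositions_def)
  show ?thesis
    unfolding insert_ones_sum_def using raise
    by (simp add: d sum_weak_compositions_Suc_Suc insert_ones_Cons[OF assms])
qed

lemma insert_ones_convolution_cong:
  assumes "index ks" "ks \<noteq> []" "\<And>js l. index js \<Longrightarrow> js \<noteq> [] \<Longrightarrow> F js l = G js l"
  shows "insert_ones_convolution F ks t = insert_ones_convolution G ks t"
  unfolding insert_ones_convolution_def using assms by (intro sum.cong insert_ones_sum_cong) auto

lemma insert_ones_convolution_0: "ks \<noteq> [] \<Longrightarrow> insert_ones_convolution F ks 0 = F ks 0"
  by (simp add: insert_ones_convolution_def insert_ones_sum_0)

lemma insert_ones_convolution_singleton: "insert_ones_convolution F [k] t = F [k] t"
proof -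
  have "insert_ones_convolution F [k] t = (\<Sum>l\<le>t. if l = t then F [k] t else 0)"
    unfolding insert_ones_convolution_def insert_ones_sum_singleton by (intro sum.cong) auto
  then show ?thesis by simp
qed

lemma insert_ones_convolution_raise_hd:
  "ks \<noteq> [] \<Longrightarrow>
    insert_ones_convolution F (raise_hd ks) t = insert_ones_convolution (\<lambda>js. F (raise_hd js)) ks t"
  by (simp add: insert_ones_convolution_def insert_ones_sum_raise_hd)

lemma insert_ones_convolution_Cons_1_Suc:
  assumes "ks \<noteq> []"
  shows "insert_ones_convolution F (1 # ks) (Suc t) =
    insert_ones_convolution (\<lambda>js. F (1 # js)) ks (Suc t) +
    insert_ones_convolution (\<lambda>js. F (1 # js)) (1 # ks) t"
  using assms
  by (simp add: insert_ones_convolution_def Suc_diff_le insert_ones_sum_0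
      insert_ones_sum_Cons_1_Suc sum.distrib ac_simps del: One_nat_def)

lemma insert_ones_convolution_dual_ohno_sum_Cons_1_Suc:
  assumes "index ks" "ks \<noteq> []"
  shows "insert_ones_convolution (dual_ohno_sum f) (1 # ks) (Suc t) =
    insert_ones_convolution (dual_ohno_sum (\<lambda>js. f (1 # js))) ks (Suc t) +
    insert_ones_convolution (dual_ohno_sum (\<lambda>js. f (1 # js))) (1 # ks) t"
proof -
  have "insert_ones_convolution (\<lambda>js. dual_ohno_sum f (1 # js)) ls n =
      insert_ones_convolution (dual_ohno_sum (\<lambda>js. f (1 # js))) ls n"
    if "index ls" "ls \<noteq> []" for ls n
    using that by (intro insert_ones_convolution_cong dual_ohno_sum_Cons_1) auto
  then show ?thesis
    using assms by (simp add: insert_ones_convolution_Cons_1_Suc del: One_nat_def)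
qed

lemma insert_ones_convolution_dual_ohno_sum_raise_hd_Suc:
  assumes "index ks" "ks \<noteq> []"
  shows "insert_ones_convolution (dual_ohno_sum f) (raise_hd ks) (Suc t) =
    insert_ones_convolution (dual_ohno_sum (\<lambda>js. f (raise_hd js))) ks (Suc t) +
    insert_ones_convolution (dual_ohno_sum (\<lambda>js. f (1 # js))) (raise_hd ks) t"
proof -
  let ?plus = "\<lambda>js. f (raise_hd js)" and ?comma = "\<lambda>js. f (1 # js)"
  have level_0: "insert_ones_sum (\<lambda>js. dual_ohno_sum f (raise_hd js) 0) ks n =
      insert_ones_sum (\<lambda>js. dual_ohno_sum ?plus js 0) ks n" for n
    using assms by (rule insert_ones_sum_cong) (simp add: dual_ohno_sum_0 index_raise_hd)
  have level_Suc: "insert_ones_sum (\<lambda>js. dual_ohno_sum f (raise_hd js) (Suc l)) ks n =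
      insert_ones_sum (\<lambda>js. dual_ohno_sum ?plus js (Suc l)) ks n +
      insert_ones_sum (\<lambda>js. dual_ohno_sum ?comma (raise_hd js) l) ks n" for l n
    unfolding insert_ones_sum_add[symmetric]
    using assms by (rule insert_ones_sum_cong) (simp add: dual_ohno_sum_raise_hd_Suc)
  show ?thesis
    unfolding insert_ones_convolution_raise_hd[OF assms(2)]
    by (simp add: insert_ones_convolution_def sum.atMost_Suc_shift level_0 level_Suc sum.distrib
        ac_simps del: sum.atMost_Suc)
qed

lemma insert_ones_convolution_eq_leading_term:
  "ks \<noteq> [] \<Longrightarrow> insert_ones_convolution F ks t =
    F ks t + (\<Sum>l<t. insert_ones_sum (\<lambda>js. F js l) ks (t - l))"
  by (simp add: insert_ones_convolution_def insert_ones_sum_0 ac_simps flip: lessThan_Suc_atMost)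

lemma insert_ones_convolution_cancel:
  fixes F G :: "nat list \<Rightarrow> nat \<Rightarrow> 'a :: cancel_comm_monoid_add"
  assumes eq: "\<And>ks t. index ks \<Longrightarrow> ks \<noteq> [] \<Longrightarrow>
      insert_ones_convolution F ks t = insert_ones_convolution G ks t"
    and "index ks" "ks \<noteq> []"
  shows "F ks l = G ks l"
  using assms(2,3)
proof (induction l arbitrary: ks rule: less_induct)
  case (less l)
  have "(\<Sum>j<l. insert_ones_sum (\<lambda>js. F js j) ks (l - j)) =
      (\<Sum>j<l. insert_ones_sum (\<lambda>js. G js j) ks (l - j))"
    using less by (intro sum.cong insert_ones_sum_cong) auto
  then show ?case
    using eq[OF less.prems, of l] less.prems(2)
    by (simp add: insert_ones_convolution_eq_leading_term)
qed

section \<open>Replacing the entries of an index by blocks\<close>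

definition block_compositions :: "nat list \<Rightarrow> nat list \<Rightarrow> nat list list set" where
  "block_compositions ks ms = {as. length as = length ks \<and>
     (\<forall>i<length ks. as ! i \<in> compositions (ms ! i) (ks ! i + ms ! i - 1))}"

definition block_sum :: "(nat list \<Rightarrow> 'a :: comm_monoid_add) \<Rightarrow> nat list \<Rightarrow> nat \<Rightarrow> 'a" where
  "block_sum f ks t =
     (\<Sum>ms\<in>compositions (length ks) (length ks + t). \<Sum>as\<in>block_compositions ks ms. f (concat as))"

lemma block_compositions_Cons:
  "block_compositions (k # ks) (m # ms) =
     (\<lambda>(a, as). a # as) ` (compositions m (k + m - 1) \<times> block_compositions ks ms)"
proof -
  have "as \<in> block_compositions (k # ks) (m # ms) \<longleftrightarrow>
      (\<exists>b bs. as = b # bs \<and> b \<in> compositions m (k + m - 1) \<and> bs \<in> block_compositions ks ms)" for as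
    by (cases as) (auto simp: block_compositions_def All_less_Suc2)
  then show ?thesis by auto
qed

lemma sum_block_compositions_Cons:
  "(\<Sum>as\<in>block_compositions (Suc k # ks) (Suc m # ms). f (concat as)) =
     (\<Sum>es\<in>weak_compositions (Suc m) k. \<Sum>as\<in>block_compositions ks ms. f (map Suc es @ concat as))"
proof -
  have "inj_on (\<lambda>(a, as). a # as) X" for X :: "(nat list \<times> nat list list) set"
    by (auto simp: inj_on_def)
  then have "(\<Sum>as\<in>block_compositions (Suc k # ks) (Suc m # ms). f (concat as)) =
      (\<Sum>a\<in>compositions (Suc m) (Suc m + k). \<Sum>as\<in>block_compositions ks ms. f (a @ concat as))"
    by (simp add: block_compositions_Cons sum.reindex sum.cartesian_product case_prod_unfold
        add.commute)
  then show ?thesis unfolding sum_compositions .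
qed

lemma block_sum_Nil: "block_sum f [] t = (if t = 0 then f [] else 0)"
  using sum_compositions[of "\<lambda>_. f []" 0 t]
  by (simp add: block_sum_def block_compositions_def weak_compositions_0)

lemma block_sum_Cons:
  "block_sum f (Suc k # ks) t =
     (\<Sum>j\<le>t. \<Sum>es\<in>weak_compositions (Suc j) k. block_sum (\<lambda>js. f (map Suc es @ js)) ks (t - j))"
proof -
  have "block_sum f (Suc k # ks) t =
      (\<Sum>j\<le>t. \<Sum>ms\<in>weak_compositions (length ks) (t - j). \<Sum>es\<in>weak_compositions (Suc j) k.
        \<Sum>as\<in>block_compositions ks (map Suc ms). f (map Suc es @ concat as))"
    unfolding block_sum_def sum_compositions
    by (simp add: sum_weak_compositions_Suc[where n = t] sum_block_compositions_Cons)
  also have "\<dots> =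
      (\<Sum>j\<le>t. \<Sum>es\<in>weak_compositions (Suc j) k. block_sum (\<lambda>js. f (map Suc es @ js)) ks (t - j))"
    unfolding block_sum_def sum_compositions by (intro sum.cong refl sum.swap)
  finally show ?thesis .
qed

lemma block_sum_0: "index ks \<Longrightarrow> block_sum f ks 0 = f ks"
proof (induction ks arbitrary: f)
  case (Cons k ks)
  then obtain k' where "k = Suc k'" by (cases k) auto
  with Cons show ?case by (simp add: block_sum_Cons weak_compositions_1)
qed (simp add: block_sum_Nil)

lemma block_sum_Cons_1:
  "block_sum f (1 # ks) t = (\<Sum>j\<le>t. block_sum (\<lambda>js. f (replicate (Suc j) 1 @ js)) ks (t - j))"
  by (simp add: block_sum_Cons weak_compositions_zero_sum)

lemma block_sum_1: "block_sum f [1] t = f (replicate (Suc t) 1)"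
proof -
  have "block_sum f [1] t = (\<Sum>j\<le>t. if j = t then f (replicate (Suc t) 1) else 0)"
    unfolding block_sum_Cons_1 block_sum_Nil by (intro sum.cong) auto
  then show ?thesis by simp
qed

lemma block_sum_Cons_1_Suc:
  "block_sum f (1 # ks) (Suc t) =
     block_sum (\<lambda>js. f (1 # js)) ks (Suc t) + block_sum (\<lambda>js. f (1 # js)) (1 # ks) t"
  unfolding block_sum_Cons_1 sum.atMost_Suc_shift by simp

lemma block_sum_raise_hd_Suc:
  assumes "index ks" "ks \<noteq> []"
  shows "block_sum f (raise_hd ks) (Suc t) =
    block_sum (\<lambda>js. f (raise_hd js)) ks (Suc t) + block_sum (\<lambda>js. f (1 # js)) (raise_hd ks) t"
proof -
  obtain k js where ks: "ks = Suc k # js"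
    using assms by (cases ks) (auto simp: Suc_le_eq gr0_conv_Suc)
  have raise_hd_map_Suc: "map Suc (raise_hd es) @ vs = raise_hd (map Suc es @ vs)"
    if "es \<in> weak_compositions (Suc j) k" for es vs j
    using that by (cases es) (auto simp: weak_compositions_def)
  have "block_sum f (raise_hd ks) (Suc t) =
      (\<Sum>j\<le>Suc t. \<Sum>es\<in>weak_compositions j (Suc k).
        block_sum (\<lambda>vs. f (1 # map Suc es @ vs)) js (Suc t - j)) +
      (\<Sum>j\<le>Suc t. \<Sum>es\<in>weak_compositions (Suc j) k.
        block_sum (\<lambda>vs. f (raise_hd (map Suc es @ vs))) js (Suc t - j))"
    by (simp add: ks block_sum_Cons sum_weak_compositions_Suc_Suc sum.distrib
        raise_hd_map_Suc del: sum.atMost_Suc)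
  also have "(\<Sum>j\<le>Suc t. \<Sum>es\<in>weak_compositions j (Suc k).
        block_sum (\<lambda>vs. f (1 # map Suc es @ vs)) js (Suc t - j)) =
      block_sum (\<lambda>js. f (1 # js)) (raise_hd ks) t"
    by (simp add: ks block_sum_Cons sum.atMost_Suc_shift weak_compositions_0 del: sum.atMost_Suc)
  finally show ?thesis
    by (simp add: ks block_sum_Cons add.commute del: sum.atMost_Suc)
qed

lemma block_sum_eq_insert_ones_convolution:
  assumes "index ks" "ks \<noteq> []"
  shows "block_sum f ks t = insert_ones_convolution (dual_ohno_sum f) ks t"
  using assms
proof (induction ks arbitrary: f t rule: nonempty_index_induct)
  case one
  show ?case
    unfolding block_sum_1 insert_ones_convolution_singleton dual_ohno_sum_1 ..
next
  case (comma ks)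
  show ?case
  proof (induction t arbitrary: f)
    case 0
    show ?case
      using comma.hyps by (simp add: block_sum_0 insert_ones_convolution_0 dual_ohno_sum_0)
  next
    case (Suc t)
    show ?case
      unfolding block_sum_Cons_1_Suc
        insert_ones_convolution_dual_ohno_sum_Cons_1_Suc[OF comma.hyps(1,2)] comma.IH Suc.IH ..
  qed
next
  case (plus ks)
  show ?case
  proof (induction t arbitrary: f)
    case 0
    show ?case
      using plus.hyps
      by (simp add: block_sum_0 insert_ones_convolution_0 dual_ohno_sum_0 index_raise_hd)
  next
    case (Suc t)
    show ?case
      unfolding block_sum_raise_hd_Suc[OF plus.hyps(1,2)]
        insert_ones_convolution_dual_ohno_sum_raise_hd_Suc[OF plus.hyps(1,2)] plus.IH Suc.IH ..
  qed
qed

theorem block_sum_relation_iff_ohno_sum_relation: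
  fixes f :: "nat list \<Rightarrow> 'a :: cancel_comm_monoid_add"
  shows "(\<forall>ks t. index ks \<and> ks \<noteq> [] \<longrightarrow>
      block_sum f ks t = insert_ones_convolution (ohno_sum f) ks t) \<longleftrightarrow>
    (\<forall>ks l. index ks \<and> ks \<noteq> [] \<longrightarrow> ohno_sum f ks l = dual_ohno_sum f ks l)"
  (is "?A \<longleftrightarrow> ?B")
proof
  assume A: ?A
  show ?B
  proof (intro allI impI)
    fix ks l assume "index ks \<and> ks \<noteq> []"
    moreover have "insert_ones_convolution (ohno_sum f) js t =
        insert_ones_convolution (dual_ohno_sum f) js t" if "index js" "js \<noteq> []" for js t
      using A that by (simp flip: block_sum_eq_insert_ones_convolution)
    ultimately show "ohno_sum f ks l = dual_ohno_sum f ks l"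
      using insert_ones_convolution_cancel[of "ohno_sum f" "dual_ohno_sum f" ks l] by simp
  qed
next
  assume B: ?B
  show ?A
  proof (intro allI impI)
    fix ks t assume ks: "index ks \<and> ks \<noteq> []"
    then have "block_sum f ks t = insert_ones_convolution (dual_ohno_sum f) ks t"
      by (simp add: block_sum_eq_insert_ones_convolution)
    also have "\<dots> = insert_ones_convolution (ohno_sum f) ks t"
      using B ks by (intro insert_ones_convolution_cong) auto
    finally show "block_sum f ks t = insert_ones_convolution (ohno_sum f) ks t" .
  qed
qed

theorem theorem3p3:
  shows
   "(\<forall>(r::nat) (ks::nat list) (t::nat). 1 \<le> r \<and> length ks = r \<and> index ks \<longrightarrow>
       (\<Sum>ms \<in> compositions r (r + t).
          \<Sum>as \<in> {as. length as = r \<and>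
                     (\<forall>i<r. as ! i \<in> compositions (ms ! i) (ks ! i + ms ! i - 1))}.
            mzv_plus (concat as))
       = (\<Sum>l=0..t. \<Sum>ms \<in> weak_compositions (r - 1) (t - l).
            \<Sum>es \<in> weak_compositions (length (insert_ones ks ms)) l.
              mzv_plus (tuple_add (insert_ones ks ms) es)))
    \<longleftrightarrow>
    (\<forall>(r::nat) (ks::nat list) (l::nat). 1 \<le> r \<and> length ks = r \<and> index ks \<longrightarrow>
       (\<Sum>es \<in> weak_compositions (length ks) l. mzv_plus (tuple_add ks es))
       = (\<Sum>es' \<in> weak_compositions (length (hoffman_dual ks)) l.
            mzv_plus (hoffman_dual (tuple_add (hoffman_dual ks) es'))))"
proof -
  have "1 \<le> r \<and> length ks = r \<and> index ks \<longleftrightarrow> length ks = r \<and> index ks \<and> ks \<noteq> []"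
    for r and ks :: "nat list"
    by (cases ks) auto
  then show ?thesis
    using block_sum_relation_iff_ohno_sum_relation[of mzv_plus]
    unfolding block_sum_def block_compositions_def insert_ones_convolution_def insert_ones_sum_def
      dual_ohno_sum_def ohno_sum_def atMost_atLeast0
    by simp
qed

end
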